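(* The generating function of interval-closed sets of truncated rectangles can be expressed as $$\sum_{r\in\mathbb{Z}}\ \sum_{m,n\ge \max(0, r)} \left|\mathcal{IC}(P_{m\times n;r})\right|t^{n-r}x^{m-r}z^{m+n}=G(t,x,0,z),$$ where $G(x,y):=G(t,x,y,z)$ is a formal power series in $t,z$ with coefficients that are polynomials in $x,y$, satisfying the functional equation $$G(x,y)= \frac{1}{1-tx}+z\left(x+\frac{1}{x}+\frac{x}{y}+\frac{y}{x}\right)G(x,y) - z \left(\frac{1}{x}+\frac{y}{x}\right)G(0,y) - z\, \frac{x}{y} G(x,0) - z^2\, \left(G(x,0)-G(0,0)\right).$$
   Context: For a finite poset $P$, a subset $I\subseteq P$ is an interval-closed set if for all $a,b\in I$ and $w\in P$ with $a<w<b$ we have $w\in I$; $\mathcal{IC}(P)$ is the set of all interval-closed sets of $P$ (including the empty set, so an empty poset has exactly one ICS). $[m]\times[n]=\{(i,j): 1\le i\le m,\ 1\le j\le n\}$ is ordered componentwise (empty if $m=0$ or $n=0$). For $r\ge0$ with $r\le m,n$, $P_{m\times n;r}$ is the poset obtained from $[m]\times[n]$ by truncating (removing) its bottom $r$ ranks, i.e. $P_{m\times n;r}=\{(a,b)\in[m]\times[n]: a+b-2\ge r\}$ with the induced order; for $r<0$, $P_{m\times n;r}=P_{m\times n;0}=[m]\times[n]$. In the functional equation the variables $t,z$ are suppressed: $G(0,y)=G(t,0,y,z)$, $G(x,0)=G(t,x,0,z)$, $G(0,0)=G(t,0,0,z)$. *)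

theory Defs
  imports "HOL-Computational_Algebra.Computational_Algebra" "HOL-Library.Product_Order"
begin

text \<open>A finite poset is represented by a set of elements of an ordered type, with the induced
  order.  On pairs, \<open>HOL-Library.Product_Order\<close> makes \<open>\<le>\<close> the componentwise order.\<close>

definition interval_closed :: "'a::order set \<Rightarrow> 'a set \<Rightarrow> bool" where
  "interval_closed P I \<longleftrightarrow>
     I \<subseteq> P \<and> (\<forall>a\<in>I. \<forall>b\<in>I. \<forall>w\<in>P. a < w \<and> w < b \<longrightarrow> w \<in> I)"

definition interval_closed_sets :: "'a::order set \<Rightarrow> 'a set set" where
  "interval_closed_sets P = {I. interval_closed P I}"

definition truncated_rectangle :: "nat \<Rightarrow> nat \<Rightarrow> int \<Rightarrow> (nat \<times> nat) set" where
  "truncated_rectangle m n r =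
     {(a, b). a \<in> {1..m} \<and> b \<in> {1..n} \<and> int a + int b - 2 \<ge> max 0 r}"

text \<open>Elements of \<open>\<int>[x,y]\<close> are of type \<^typ>\<open>int poly poly\<close>, with \<open>x\<close> the inner and \<open>y\<close> the outer
  variable.  Power series in \<open>t\<close> and \<open>z\<close> over \<open>\<int>[x,y]\<close> are of type \<^typ>\<open>int poly poly fps fps\<close>,
  with \<open>t\<close> the inner and \<open>z\<close> the outer variable: the coefficient of \<open>t\<^sup>i z\<^sup>k\<close> in \<open>G\<close> is
  \<open>fps_nth (fps_nth G k) i\<close>.\<close>

definition map_coeffs :: "('a \<Rightarrow> 'b) \<Rightarrow> 'a fps fps \<Rightarrow> 'b fps fps" where
  "map_coeffs f G = Abs_fps (\<lambda>k. Abs_fps (\<lambda>i. f (fps_nth (fps_nth G k) i)))"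

text \<open>\<open>G(0,y)\<close> and \<open>G(x,0)\<close>; hence \<open>G(0,0)\<close> is \<open>at_x0 (at_y0 G)\<close>.\<close>

definition at_x0 :: "int poly poly fps fps \<Rightarrow> int poly poly fps fps" where
  "at_x0 = map_coeffs (map_poly (\<lambda>q. [:poly q 0:]))"

definition at_y0 :: "int poly poly fps fps \<Rightarrow> int poly poly fps fps" where
  "at_y0 = map_coeffs (\<lambda>p. [:poly p 0:])"

text \<open>The functional equation involves \<open>1/x\<close> and \<open>1/y\<close>, so it is stated for power series in
  \<open>t\<close>, \<open>z\<close> over the field \<open>\<rat>(x,y)\<close>, rendered as the fraction field of \<open>\<int>[x,y]\<close>.\<close>

definition embed :: "int poly poly fps fps \<Rightarrow> int poly poly fract fps fps" where
  "embed = map_coeffs to_fract"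

definition functional_equation :: "int poly poly fps fps \<Rightarrow> bool" where
  "functional_equation G \<longleftrightarrow>
     (let x = to_fract [:[:0, 1:]:] :: int poly poly fract;
          y = to_fract [:0, 1:] :: int poly poly fract;
          c = (\<lambda>u. fps_const (fps_const u)) :: int poly poly fract \<Rightarrow> int poly poly fract fps fps;
          t = fps_X :: int poly poly fract fps;
          z = fps_X :: int poly poly fract fps fps
      in embed G =
           fps_const (1 / (1 - t * fps_const x))
           + z * c (x + 1 / x + x / y + y / x) * embed G
           - z * c (1 / x + y / x) * embed (at_x0 G)
           - z * c (x / y) * embed (at_y0 G)
           - z ^ 2 * (embed (at_y0 G) - embed (at_x0 (at_y0 G))))"

text \<open>The triples \<open>(r, m, n)\<close> in the range of summation whose term is a multiple of \<open>t\<^sup>i z\<^sup>k\<close>.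
  There are finitely many of them, so the infinite formal sum is well defined coefficientwise.\<close>

definition contributing :: "nat \<Rightarrow> nat \<Rightarrow> (int \<times> nat \<times> nat) set" where
  "contributing i k =
     {(r, m, n). int m \<ge> max 0 r \<and> int n \<ge> max 0 r \<and> int n - r = int i \<and> m + n = k}"

lemma finite_contributing: "finite (contributing i k)"
proof (rule finite_subset)
  show "contributing i k \<subseteq> (\<lambda>(m, n). (int n - int i, m, n)) ` ({..k} \<times> {..k})"
    by (force simp: contributing_def)
qed simp

text \<open>The left-hand side; its coefficients, which are polynomials in \<open>x\<close> alone, are embedded into
  \<open>\<int>[x,y]\<close> as constants in \<open>y\<close>.  The conversion \<^const>\<open>nat\<close> does not truncate, because
  \<open>m \<ge> r\<close>.\<close>

definition ics_gf :: "int poly poly fps fps" where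
  "ics_gf = Abs_fps (\<lambda>k. Abs_fps (\<lambda>i.
     [:\<Sum>(r, m, n)\<in>contributing i k.
         monom (int (card (interval_closed_sets (truncated_rectangle m n r)))) (nat (int m - r)):]))"

end

theory Submission
  imports Defs
begin

text \<open>An interval-closed set is a difference of two upsets, and an upset of a truncated rectangle is
  the set of cells above a lattice path with steps \<open>\<plusminus>1\<close> that stays non-negative.  So
  interval-closed sets become pairs of lattice paths \<open>l \<le> u\<close> with common endpoints, which are walks
  in the quarter plane with the coordinates \<open>l\<close> and \<open>(u - l) / 2\<close>; the two paths going up or down
  independently give the four steps \<open>(1,0)\<close>, \<open>(-1,0)\<close>, \<open>(1,-1)\<close>, \<open>(-1,1)\<close> behind the factor
  \<open>x + 1/x + x/y + y/x\<close> of the functional equation.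

  The pair of upsets is not determined by the interval-closed set \<open>I\<close>.  It becomes unique if the
  larger upset is the one generated by \<open>I\<close>, which means that none of its minimal elements lies in
  the smaller upset (\<open>upset_pairs_bij\<close>).  Minimal cells above \<open>l\<close> are the valleys of \<open>l\<close>, so the
  condition on paths is that \<open>u\<close> runs strictly above \<open>l\<close> at every valley of \<open>l\<close>
  (\<open>upset_pairs_bij_path_pairs\<close>).

  Removing the last step gives a recursion for the number of such pairs with prescribed endpoints
  (\<open>path_pair_count_Suc\<close>).  A step that creates a forbidden valley leads from \<open>(a - 1, 0)\<close> to
  \<open>(a, 0)\<close> right after the step from \<open>(a, 0)\<close> to \<open>(a - 1, 0)\<close>; this double step is the term
  \<open>z\<^sup>2 (G(x,0) - G(0,0))\<close>.  The functional equation says exactly that the coefficients of \<open>G\<close> obey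
  this recursion (\<open>functional_equation_iff\<close>): the subtracted terms \<open>G(0,y)\<close> and \<open>G(x,0)\<close> are what
  makes the divisions by \<open>x\<close> and \<open>y\<close> exact, and they remove the steps that leave the quarter plane.
  The paths for \<open>r\<close>, \<open>m\<close>, \<open>n\<close> have length \<open>m + n\<close> and lead from height \<open>n - r\<close> to height \<open>m - r\<close>,
  whence the exponents of \<open>z\<close>, \<open>t\<close> and \<open>x\<close>; both paths end at the same height, so \<open>y = 0\<close>.\<close>

section \<open>Interval-closed sets as pairs of upsets\<close>

definition upset_in :: "'a::order set \<Rightarrow> 'a set \<Rightarrow> bool" where
  "upset_in P A \<longleftrightarrow> A \<subseteq> P \<and> (\<forall>a\<in>A. \<forall>b\<in>P. a \<le> b \<longrightarrow> b \<in> A)"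

definition minimal_in :: "'a::order set \<Rightarrow> 'a \<Rightarrow> bool" where
  "minimal_in A c \<longleftrightarrow> c \<in> A \<and> (\<forall>d\<in>A. \<not> d < c)"

definition upset_pairs :: "'a::order set \<Rightarrow> ('a set \<times> 'a set) set" where
  "upset_pairs P = {(A, B). upset_in P A \<and> upset_in P B \<and> B \<subseteq> A \<and> (\<forall>c. minimal_in A c \<longrightarrow> c \<notin> B)}"

lemma ex_minimal_below:
  assumes "finite A" "c \<in> A"
  shows "\<exists>d. minimal_in A d \<and> d \<le> c"
proof -
  obtain d where "d \<in> A" "d \<le> c" "\<forall>e\<in>A. e \<le> d \<longrightarrow> d = e"
    using finite_has_minimal2[OF assms] by metis
  then show ?thesis
    unfolding minimal_in_def by (metis order.strict_implies_order order.strict_implies_not_eq)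
qed

text \<open>The inverse map sends \<open>I\<close> to its upward closure \<open>up I\<close> and to \<open>up I - I\<close>; the latter is an upset
  because \<open>I\<close> is interval-closed.  Conversely \<open>up (A - B) = A\<close>: every element of the finite set
  \<open>A\<close> lies above a minimal one, and the minimal elements of \<open>A\<close> survive in \<open>A - B\<close>.\<close>

lemma upset_pairs_bij:
  fixes P :: "'a::order set"
  assumes fin: "finite P"
  shows "bij_betw (\<lambda>(A, B). A - B) (upset_pairs P) (interval_closed_sets P)"
proof -
  define up where "up I = {w \<in> P. \<exists>a\<in>I. a \<le> w}" for I
  have up_diff: "up (A - B) = A" if "(A, B) \<in> upset_pairs P" for A B
  proof -
    have A: "A \<subseteq> P" "\<And>a b. a \<in> A \<Longrightarrow> b \<in> P \<Longrightarrow> a \<le> b \<Longrightarrow> b \<in> A"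
      and mn: "\<And>c. minimal_in A c \<Longrightarrow> c \<notin> B"
      using that by (auto simp: upset_pairs_def upset_in_def)
    have "w \<in> up (A - B)" if w: "w \<in> A" for w
    proof -
      obtain d where d: "minimal_in A d" "d \<le> w"
        using ex_minimal_below[OF finite_subset[OF A(1) fin] w] by blast
      then have "d \<in> A - B" using mn by (auto simp: minimal_in_def)
      then show ?thesis using d A w by (auto simp: up_def)
    qed
    then show ?thesis using A by (auto simp: up_def)
  qed
  show ?thesis
  proof (rule bij_betw_byWitness[where f' = "\<lambda>I. (up I, up I - I)"])
    show "\<forall>p\<in>upset_pairs P. (\<lambda>I. (up I, up I - I)) ((\<lambda>(A, B). A - B) p) = p"
    proof clarify
      fix A B assume AB: "(A, B) \<in> upset_pairs P"
      then have "B \<subseteq> A" by (simp add: upset_pairs_def)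
      then show "up (A - B) = A \<and> up (A - B) - (A - B) = B" using up_diff[OF AB] by blast
    qed
    show "\<forall>I\<in>interval_closed_sets P. (\<lambda>(A, B). A - B) (up I, up I - I) = I"
      by (auto simp: interval_closed_sets_def interval_closed_def up_def)
    show "(\<lambda>(A, B). A - B) ` upset_pairs P \<subseteq> interval_closed_sets P"
    proof clarify
      fix A B assume AB: "(A, B) \<in> upset_pairs P"
      then have A: "A \<subseteq> P" "\<And>a b. a \<in> A \<Longrightarrow> b \<in> P \<Longrightarrow> a < b \<Longrightarrow> b \<in> A"
        and B: "\<And>a b. a \<in> B \<Longrightarrow> b \<in> P \<Longrightarrow> a < b \<Longrightarrow> b \<in> B"
        by (auto simp: upset_pairs_def upset_in_def order.strict_iff_order)
      show "A - B \<in> interval_closed_sets P"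
        unfolding interval_closed_sets_def interval_closed_def
      proof (intro CollectI conjI ballI impI)
        fix a b w assume "a \<in> A - B" "b \<in> A - B" "w \<in> P" "a < w \<and> w < b"
        then show "w \<in> A - B" using A B by blast
      qed (use A in blast)
    qed
    show "(\<lambda>I. (up I, up I - I)) ` interval_closed_sets P \<subseteq> upset_pairs P"
    proof clarify
      fix I assume "I \<in> interval_closed_sets P"
      then have IP: "I \<subseteq> P"
        and conv: "\<And>a b w. a \<in> I \<Longrightarrow> b \<in> I \<Longrightarrow> w \<in> P \<Longrightarrow> a < w \<Longrightarrow> w < b \<Longrightarrow> w \<in> I"
        unfolding interval_closed_sets_def interval_closed_def by blast+
      have "upset_in P (up I)" unfolding upset_in_def up_def using order.trans by blast
      moreover have "upset_in P (up I - I)"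
        unfolding upset_in_def
      proof (intro conjI ballI impI)
        fix v w assume v: "v \<in> up I - I" and w: "w \<in> P" and vw: "v \<le> w"
        then obtain a where a: "a \<in> I" "a \<le> v" "v \<in> P" "v \<notin> I" by (auto simp: up_def)
        then have "a < v" by (metis order.order_iff_strict)
        have "w \<notin> I"
        proof
          assume wI: "w \<in> I"
          with a vw have "v < w" by (metis order.order_iff_strict)
          with conv[OF a(1) wI a(3) \<open>a < v\<close>] a(4) show False by blast
        qed
        moreover have "w \<in> up I" unfolding up_def using a w vw order.trans by blast
        ultimately show "w \<in> up I - I" by blast
      qed (auto simp: up_def)
      moreover have "c \<in> I" if "minimal_in (up I) c" for c
      proof -
        have "c \<in> up I" using that by (simp add: minimal_in_def)
        then obtain a where a: "a \<in> I" "a \<le> c" by (auto simp: up_def)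
        moreover have "a \<in> up I" using a IP by (auto simp: up_def)
        ultimately show ?thesis
          using that by (metis minimal_in_def order.order_iff_strict)
      qed
      ultimately show "(up I, up I - I) \<in> upset_pairs P"
        by (auto simp: upset_pairs_def)
    qed
  qed
qed

section \<open>Upsets of truncated rectangles as lattice paths\<close>

text \<open>Paths are functions that vanish beyond their length \<open>k\<close>, so that a path is determined by its
  heights at times \<open>0\<close> to \<open>k\<close> and the pointwise order compares exactly these.\<close>

definition lattice_paths :: "nat \<Rightarrow> int \<Rightarrow> int \<Rightarrow> (nat \<Rightarrow> int) set" where
  "lattice_paths k i a = {h. h 0 = i \<and> h k = a \<and> (\<forall>s<k. \<bar>h (Suc s) - h s\<bar> = 1)
                             \<and> (\<forall>s. 0 \<le> h s) \<and> (\<forall>s>k. h s = 0)}"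

definition valley :: "(nat \<Rightarrow> int) \<Rightarrow> nat \<Rightarrow> bool" where
  "valley h s \<longleftrightarrow> h (s - 1) = h s + 1 \<and> h (s + 1) = h s + 1"

text \<open>The end of the walk is \<open>(a, b)\<close> in the coordinates \<open>(l, (u - l) / 2)\<close>; paths with a common start
  always differ by an even number.\<close>

definition path_pairs :: "nat \<Rightarrow> int \<Rightarrow> int \<Rightarrow> int \<Rightarrow> ((nat \<Rightarrow> int) \<times> (nat \<Rightarrow> int)) set" where
  "path_pairs k i a b = {(l, u). l \<in> lattice_paths k i a \<and> u \<in> lattice_paths k i (a + 2 * b) \<and> l \<le> u
       \<and> (\<forall>s. 0 < s \<and> s < k \<and> valley l s \<longrightarrow> l s < u s)}"

lemma lattice_path_lipschitz:
  assumes "h \<in> lattice_paths k i a" "s \<le> k" "s' \<le> k"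
  shows "\<bar>h s' - h s\<bar> \<le> \<bar>int s' - int s\<bar>"
proof -
  have *: "\<bar>h v - h w\<bar> \<le> int v - int w" if "w \<le> v" "v \<le> k" for v w
    using that
  proof (induction v rule: dec_induct)
    case (step v)
    then have "\<bar>h (Suc v) - h v\<bar> = 1" using assms(1) by (auto simp: lattice_paths_def)
    then show ?case using step by linarith
  qed simp
  show ?thesis
    using *[of s s'] *[of s' s] assms by (cases "s \<le> s'") auto
qed

lemma lattice_path_parity:
  assumes "h \<in> lattice_paths k i a" "s \<le> k"
  shows "even (h s + i + int s)"
  using assms(2)
proof (induction s)
  case 0 then show ?case using assms(1) by (auto simp: lattice_paths_def)
next
  case (Suc s)
  then have "\<bar>h (Suc s) - h s\<bar> = 1" using assms(1) by (auto simp: lattice_paths_def)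
  then have "h (Suc s) = h s + 1 \<or> h (Suc s) = h s - 1" by linarith
  then show ?case using Suc by auto
qed

lemma lattice_path_nonneg: "h \<in> lattice_paths k i a \<Longrightarrow> 0 \<le> h s"
  by (simp add: lattice_paths_def)

lemma lattice_path_ends: "h \<in> lattice_paths k i a \<Longrightarrow> h 0 = i \<and> h k = a"
  by (simp add: lattice_paths_def)

lemma lattice_path_step: "h \<in> lattice_paths k i a \<Longrightarrow> s < k \<Longrightarrow> \<bar>h (Suc s) - h s\<bar> = 1"
  by (simp add: lattice_paths_def)

text \<open>The rectangle is drawn with its bottom corner down, and its grid points \<open>(p, q)\<close> with
  \<open>0 \<le> p \<le> m\<close>, \<open>0 \<le> q \<le> n\<close> have abscissa \<open>n + p - q\<close> and height \<open>p + q - r\<close>.  A path goes from the left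
  corner \<open>(0, n)\<close> to the right corner \<open>(m, 0)\<close>.  The element \<open>(a, b)\<close> of the poset is the unit square
  with bottom corner \<open>(a - 1, b - 1)\<close>; \<open>diagonal\<close> and \<open>level\<close> are the coordinates of that corner.\<close>

locale truncated_rect =
  fixes m n :: nat and r :: int
  assumes rm: "r \<le> int m" and rn: "r \<le> int n"
begin

abbreviation "P \<equiv> truncated_rectangle m n r"
abbreviation "paths \<equiv> lattice_paths (m + n) (int n - r) (int m - r)"

definition diagonal :: "nat \<times> nat \<Rightarrow> nat" where "diagonal c = n + fst c - snd c"
definition level :: "nat \<times> nat \<Rightarrow> int" where "level c = int (fst c) + int (snd c) - 2 - r"

definition above :: "(nat \<Rightarrow> int) \<Rightarrow> (nat \<times> nat) set" where
  "above h = {c \<in> {1..m} \<times> {1..n}. h (diagonal c) \<le> level c}"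

lemma int_diagonal: "c \<in> {1..m} \<times> {1..n} \<Longrightarrow> int (diagonal c) = int n + int (fst c) - int (snd c)"
  by (auto simp: diagonal_def)

lemma diagonal_bounds: "c \<in> {1..m} \<times> {1..n} \<Longrightarrow> 0 < diagonal c \<and> diagonal c < m + n"
  by (auto simp: diagonal_def)

text \<open>In the rotated coordinates the elements above a given one form a cone bounded by lines of slope
  \<open>\<plusminus>1\<close>.  This is why upsets correspond to paths with steps \<open>\<plusminus>1\<close>.\<close>

lemma le_iff_cone:
  assumes "c \<in> {1..m} \<times> {1..n}" "d \<in> {1..m} \<times> {1..n}"
  shows "c \<le> d \<longleftrightarrow> level c + \<bar>int (diagonal d) - int (diagonal c)\<bar> \<le> level d"
  using assms by (auto simp: int_diagonal level_def less_eq_prod_def)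

lemma P_eq: "P = {c \<in> {1..m} \<times> {1..n}. 0 \<le> level c}"
  by (auto simp: truncated_rectangle_def level_def)

lemma finite_P: "finite P" by (simp add: P_eq)

lemma above_upset:
  assumes h: "h \<in> paths" shows "upset_in P (above h)"
  unfolding upset_in_def
proof (intro conjI ballI impI)
  show "above h \<subseteq> P"
    using lattice_path_nonneg[OF h] order.trans by (fastforce simp: above_def P_eq)
  fix c d assume c: "c \<in> above h" and d: "d \<in> P" and cd: "c \<le> d"
  have c': "c \<in> {1..m} \<times> {1..n}" and d': "d \<in> {1..m} \<times> {1..n}"
    using c d by (auto simp: above_def P_eq)
  have "h (diagonal d) \<le> h (diagonal c) + \<bar>int (diagonal d) - int (diagonal c)\<bar>"
    using lattice_path_lipschitz[OF h, of "diagonal c" "diagonal d"] diagonal_bounds[OF c'] diagonal_bounds[OF d'] by auto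
  then have "h (diagonal d) \<le> level d"
    using cd c c' d' le_iff_cone[OF c' d'] by (auto simp: above_def)
  then show "d \<in> above h" using d' by (simp add: above_def)
qed

text \<open>The bounds are the four sides of the whole rectangle.  Truncation cuts off the part below height
  \<open>0\<close>; for \<open>r < 0\<close> the rectangle lies entirely above height \<open>0\<close>, and the paths are all those of
  \<open>[m] \<times> [n]\<close>.\<close>

lemma path_bounds:
  assumes h: "h \<in> paths" and s: "s \<le> m + n"
  shows "int n - r - int s \<le> h s" "h s \<le> int n - r + int s"
    "int s - r - int n \<le> h s" "h s \<le> 2 * int m + int n - r - int s"
proof -
  have "\<bar>h s - h 0\<bar> \<le> int s" "\<bar>h (m + n) - h s\<bar> \<le> int (m + n) - int s"
    using lattice_path_lipschitz[OF h, of 0 s] lattice_path_lipschitz[OF h, of s "m + n"] s by auto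
  then show "int n - r - int s \<le> h s" "h s \<le> int n - r + int s"
    "int s - r - int n \<le> h s" "h s \<le> 2 * int m + int n - r - int s"
    using lattice_path_ends[OF h] by auto
qed

text \<open>A point of a path is the bottom corner of a cell unless it is on one of the two upper sides of the
  rectangle.  By parity, being below the sides means being below by at least two.\<close>

lemma cell_at:
  assumes h: "h \<in> paths" and s: "s \<le> m + n"
    and b1: "h s + 2 \<le> int n - r + int s" and b2: "h s + 2 \<le> 2 * int m + int n - r - int s"
  obtains c where "c \<in> {1..m} \<times> {1..n}" "diagonal c = s" "level c = h s"
proof -
  have "even (h s + (int n - r) + int s)" using lattice_path_parity[OF h s] .
  moreover have "h s + r + int s - int n = h s + (int n - r) + int s + 2 * (r - int n)" by simp
  ultimately have "even (h s + r + int s - int n)" by (metis dvd_add_left_iff dvd_triv_left)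
  then obtain p where p: "h s + r + int s - int n = 2 * p" by blast
  define q where "q = p + int n - int s"
  have q: "h s + r - int s + int n = 2 * q" using p by (simp add: q_def)
  note b = path_bounds[OF h s]
  have "0 \<le> p" "0 \<le> q" "p < int m" "q < int n" using p q b b1 b2 by auto
  then have "(nat p + 1, nat q + 1) \<in> {1..m} \<times> {1..n}" by auto
  moreover have "diagonal (nat p + 1, nat q + 1) = s"
    using \<open>0 \<le> p\<close> \<open>0 \<le> q\<close> \<open>q < int n\<close> q_def by (simp add: diagonal_def)
  moreover have "level (nat p + 1, nat q + 1) = h s"
    using \<open>0 \<le> p\<close> \<open>0 \<le> q\<close> p q_def by (simp add: level_def)
  ultimately show ?thesis using that by blast
qed

lemma above_subset_iff:
  assumes h: "h \<in> paths" and g: "g \<in> paths"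
  shows "above g \<subseteq> above h \<longleftrightarrow> h \<le> g"
proof
  assume sub: "above g \<subseteq> above h"
  show "h \<le> g"
  proof (rule le_funI, rule ccontr)
    fix s assume "\<not> h s \<le> g s"
    then have lt: "g s < h s" by simp
    then have s: "s \<le> m + n"
      using h g by (auto simp: lattice_paths_def not_le[symmetric])
    have "even (h s + (int n - r) + int s)" "even (g s + (int n - r) + int s)"
      using lattice_path_parity h g s by blast+
    then have "even (h s - g s)" by auto
    then have "h s \<noteq> g s + 1" by auto
    then have "g s + 2 \<le> h s" using lt by simp
    then have "g s + 2 \<le> int n - r + int s" "g s + 2 \<le> 2 * int m + int n - r - int s"
      using path_bounds[OF h s] by linarith+
    then obtain c where c: "c \<in> {1..m} \<times> {1..n}" "diagonal c = s" "level c = g s"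
      using cell_at[OF g s] by blast
    then have "c \<in> above g" by (simp add: above_def)
    with sub c lt show False by (auto simp: above_def)
  qed
next
  assume "h \<le> g"
  then have "h s \<le> g s" for s by (rule le_funD)
  then show "above g \<subseteq> above h" unfolding above_def using order.trans by blast
qed

lemma inj_on_above: "inj_on above paths"
proof (rule inj_onI)
  fix g h assume "g \<in> paths" "h \<in> paths" "above g = above h"
  then have "g \<le> h" "h \<le> g" using above_subset_iff by blast+
  then show "g = h" by (rule order.antisym)
qed

text \<open>The path bounding an upset \<open>A\<close> is the lower envelope of the upper boundary of the rectangle and of
  the cones over the elements of \<open>A\<close>.  It moves in steps \<open>\<plusminus>1\<close> because all these functions are
  1-Lipschitz and have the parity of a path.\<close>

lemma ex_path_of_upset:
  assumes A: "upset_in P A"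
  shows "A \<in> above ` paths"
proof -
  have AP: "A \<subseteq> P" and up: "\<And>c d. c \<in> A \<Longrightarrow> d \<in> P \<Longrightarrow> c \<le> d \<Longrightarrow> d \<in> A"
    using A by (auto simp: upset_in_def)
  have finA: "finite A" using AP finite_P finite_subset by blast
  \<comment> \<open>heights at \<open>s\<close> of the two upper sides of the rectangle and of the cones\<close>
  define K where "K s = insert (int n - r + int s) (insert (2 * int m + int n - r - int s)
     ((\<lambda>c. level c + \<bar>int s - int (diagonal c)\<bar>) ` A))" for s
  have finK: "finite (K s)" "K s \<noteq> {}" for s using finA by (auto simp: K_def)
  define h where "h s = (if s \<le> m + n then Min (K s) else 0)" for s
  have le_iff: "h s \<le> v \<longleftrightarrow> (\<exists>w\<in>K s. w \<le> v)" if "s \<le> m + n" for s v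
    using that finK by (simp add: h_def Min_le_iff)
  have ge_iff: "v \<le> h s \<longleftrightarrow> (\<forall>w\<in>K s. v \<le> w)" if "s \<le> m + n" for s v
    using that finK by (simp add: h_def)
  have inK: "h s \<in> K s" if "s \<le> m + n" for s using that finK by (simp add: h_def)
  have AR: "c \<in> {1..m} \<times> {1..n}" "0 \<le> level c" if "c \<in> A" for c using that AP P_eq by auto
  have corners: "level c + int (diagonal c) = 2 * int (fst c) - 2 + int n - r"
    "level c - int (diagonal c) = 2 * int (snd c) - 2 - int n - r" if "c \<in> {1..m} \<times> {1..n}" for c
    using int_diagonal[OF that] by (auto simp: level_def)
  \<comment> \<open>the parity that every point of a path starting at \<open>n - r\<close> has\<close>
  have evK: "even (w + (int n - r) + int s)" if "w \<in> K s" for w s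
  proof -
    have "even (level c + \<bar>int s - int (diagonal c)\<bar> + (int n - r) + int s)" if "c \<in> A" for c
    proof -
      consider "\<bar>int s - int (diagonal c)\<bar> = int s - int (diagonal c)"
        | "\<bar>int s - int (diagonal c)\<bar> = int (diagonal c) - int s" by linarith
      then show ?thesis
      proof cases
        case 1
        then have "level c + \<bar>int s - int (diagonal c)\<bar> + (int n - r) + int s
            = 2 * (int (fst c) - 1 + int n - r + int s - int (diagonal c))"
          using corners(1)[OF AR(1)[OF that]] by simp
        then show ?thesis by (metis dvd_triv_left)
      next
        case 2
        then have "level c + \<bar>int s - int (diagonal c)\<bar> + (int n - r) + int s
            = 2 * (int (fst c) - 1 + int n - r)"
          using corners(1)[OF AR(1)[OF that]] by simp
        then show ?thesis by (metis dvd_triv_left)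
      qed
    qed
    moreover have "even (int n - r + int s + (int n - r) + int s)"
      "even (2 * int m + int n - r - int s + (int n - r) + int s)" by simp_all
    ultimately show ?thesis using that unfolding K_def by blast
  qed
  have lip: "h s \<le> h s' + 1" if "s \<le> m + n" "s' \<le> m + n" "\<bar>int s - int s'\<bar> = 1" for s s'
  proof -
    note s' = that(2)
    have "\<exists>w\<in>K s. w \<le> h s' + 1"
    proof -
      consider "h s' = int n - r + int s'" | "h s' = 2 * int m + int n - r - int s'"
        | c where "c \<in> A" "h s' = level c + \<bar>int s' - int (diagonal c)\<bar>"
        using inK[OF s'] unfolding K_def by blast
      then show ?thesis
      proof cases
        case 1 then show ?thesis using that(3)
          by (intro bexI[of _ "int n - r + int s"]) (auto simp: K_def)
      next
        case 2 then show ?thesis using that(3)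
          by (intro bexI[of _ "2 * int m + int n - r - int s"]) (auto simp: K_def)
      next
        case 3 then show ?thesis using that(3)
          by (intro bexI[of _ "level c + \<bar>int s - int (diagonal c)\<bar>"]) (auto simp: K_def)
      qed
    qed
    then show ?thesis using le_iff that by blast
  qed
  have step: "\<bar>h (Suc s) - h s\<bar> = 1" if "s < m + n" for s
  proof -
    have "h s \<le> h (Suc s) + 1" "h (Suc s) \<le> h s + 1" using lip[of s "Suc s"] lip[of "Suc s" s] that by auto
    moreover have "even (h s + (int n - r) + int s)" "even (h (Suc s) + (int n - r) + int (Suc s))"
      using evK[OF inK[of s]] evK[OF inK[of "Suc s"]] that by auto
    moreover from this have "h s \<noteq> h (Suc s)" by auto
    ultimately show ?thesis by linarith
  qed
  have "h 0 = int n - r"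
  proof (rule order.antisym)
    show "h 0 \<le> int n - r" by (subst le_iff) (auto simp: K_def)
    show "int n - r \<le> h 0"
      using corners AR rn rm by (subst ge_iff) (fastforce simp: K_def)+
  qed
  moreover have "h (m + n) = int m - r"
  proof (rule order.antisym)
    show "h (m + n) \<le> int m - r" by (subst le_iff) (auto simp: K_def)
    have "int m - r \<le> level c + \<bar>int (m + n) - int (diagonal c)\<bar>" if "c \<in> A" for c
      using corners(2)[OF AR(1)[OF that]] AR(1)[OF that] by auto
    then show "int m - r \<le> h (m + n)"
      by (subst ge_iff) (auto simp: K_def)
  qed
  moreover have "0 \<le> h s" for s
  proof (cases "s \<le> m + n")
    case True
    then show ?thesis using AR rm rn by (subst ge_iff) (auto simp: K_def)
  qed (simp add: h_def)
  moreover have "h s = 0" if "m + n < s" for s using that by (simp add: h_def)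
  ultimately have "h \<in> paths" using step by (auto simp: lattice_paths_def)
  moreover have "above h = A"
  proof (intro set_eqI iffI)
    fix d assume "d \<in> above h"
    then have d: "d \<in> {1..m} \<times> {1..n}" "h (diagonal d) \<le> level d" by (auto simp: above_def)
    have "diagonal d \<le> m + n" using diagonal_bounds[OF d(1)] by simp
    then obtain w where w: "w \<in> K (diagonal d)" "w \<le> level d" using le_iff d by blast
    moreover have "level d < int n - r + int (diagonal d)" "level d < 2 * int m + int n - r - int (diagonal d)"
      using corners[OF d(1)] d(1) by auto
    ultimately obtain c where c: "c \<in> A" "level c + \<bar>int (diagonal d) - int (diagonal c)\<bar> \<le> level d"
      unfolding K_def by auto
    then have "c \<le> d" using le_iff_cone AR d by blast
    moreover have "d \<in> P" using d c AR(2)[OF c(1)] by (auto simp: P_eq)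
    ultimately show "d \<in> A" using up c by blast
  next
    fix d assume d: "d \<in> A"
    have "diagonal d \<le> m + n" using diagonal_bounds[OF AR(1)[OF d]] by simp
    moreover have "level d \<in> K (diagonal d)" using d by (force simp: K_def)
    ultimately have "h (diagonal d) \<le> level d" using le_iff by blast
    then show "d \<in> above h" using AR[OF d] by (auto simp: above_def)
  qed
  ultimately show ?thesis by blast
qed

text \<open>A cell is minimal above a path if neither of its two lower neighbours is above it, which forces
  the path to descend into the bottom corner of the cell and to ascend again.\<close>

lemma minimal_above_iff:
  assumes h: "h \<in> paths"
  shows "minimal_in (above h) c \<longleftrightarrow>
    c \<in> {1..m} \<times> {1..n} \<and> level c = h (diagonal c) \<and> valley h (diagonal c)"
proof
  assume "minimal_in (above h) c"
  then have c: "c \<in> {1..m} \<times> {1..n}" "h (diagonal c) \<le> level c"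
    and mn: "\<And>d. d \<in> above h \<Longrightarrow> \<not> d < c" by (auto simp: minimal_in_def above_def)
  obtain a b where ab: "c = (a, b)" by (cases c)
  have s: "0 < diagonal c" "diagonal c < m + n" using diagonal_bounds[OF c(1)] by auto
  have P: "int (diagonal c) = int n + int a - int b" "level c = int a + int b - 2 - r"
    "1 \<le> a" "a \<le> m" "1 \<le> b" "b \<le> n"
    using int_diagonal[OF c(1)] c(1) ab by (auto simp: level_def)
  \<comment> \<open>otherwise the lower left neighbour of \<open>c\<close> exists and is above the path\<close>
  have left: "level c \<le> h (diagonal c - 1)"
  proof (rule ccontr)
    assume "\<not> level c \<le> h (diagonal c - 1)"
    then have *: "h (diagonal c - 1) \<le> level c - 1" by simp
    have "int n - r - int (diagonal c - 1) \<le> h (diagonal c - 1)" using path_bounds(1)[OF h, of "diagonal c - 1"] s by simp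
    \<comment> \<open>the path bound shows that \<open>c\<close> is not on the lower left side of the rectangle\<close>
    then have "2 \<le> a" using * P s by auto
    then have "(a - 1, b) \<in> above h"
      using * P ab by (auto simp: above_def level_def diagonal_def algebra_simps)
    moreover have "(a - 1, b) < c" using \<open>2 \<le> a\<close> ab by (auto simp: less_prod_def less_eq_prod_def)
    ultimately show False using mn by blast
  qed
  have right: "level c \<le> h (diagonal c + 1)"
  proof (rule ccontr)
    assume "\<not> level c \<le> h (diagonal c + 1)"
    then have *: "h (diagonal c + 1) \<le> level c - 1" by simp
    have "int (diagonal c + 1) - r - int n \<le> h (diagonal c + 1)" using path_bounds(3)[OF h, of "diagonal c + 1"] s by simp
    then have "2 \<le> b" using * P s by auto
    moreover have "diagonal (a, b - 1) = diagonal c + 1" using \<open>2 \<le> b\<close> P ab by (auto simp: diagonal_def)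
    ultimately have "(a, b - 1) \<in> above h"
      using * P ab by (auto simp: above_def level_def)
    moreover have "(a, b - 1) < c" using \<open>2 \<le> b\<close> ab by (auto simp: less_prod_def less_eq_prod_def)
    ultimately show False using mn by blast
  qed
  have "even (h (diagonal c) + (int n - r) + int (diagonal c))" using lattice_path_parity[OF h] s by simp
  moreover have "h (diagonal c) + level c = h (diagonal c) + (int n - r) + int (diagonal c) + 2 * (int b - 1 - int n)"
    unfolding P by simp
  ultimately have "even (h (diagonal c) + level c)" by (metis dvd_add dvd_triv_left)
  then have "level c \<noteq> h (diagonal c) + 1" by auto
  moreover have "\<bar>h (diagonal c) - h (diagonal c - 1)\<bar> = 1" "\<bar>h (diagonal c + 1) - h (diagonal c)\<bar> = 1"
    using lattice_path_step[OF h, of "diagonal c - 1"] lattice_path_step[OF h, of "diagonal c"] s by auto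
  ultimately have "level c = h (diagonal c) \<and> valley h (diagonal c)"
    unfolding valley_def using c left right by linarith
  with c show "c \<in> {1..m} \<times> {1..n} \<and> level c = h (diagonal c) \<and> valley h (diagonal c)" by blast
next
  assume c: "c \<in> {1..m} \<times> {1..n} \<and> level c = h (diagonal c) \<and> valley h (diagonal c)"
  then have s: "0 < diagonal c" "diagonal c < m + n" using diagonal_bounds by auto
  have "\<not> d < c" if d: "d \<in> above h" for d
  proof
    assume "d < c"
    have d': "d \<in> {1..m} \<times> {1..n}" "h (diagonal d) \<le> level d" using d by (auto simp: above_def)
    have s': "diagonal d < m + n" using diagonal_bounds d' by auto
    have "fst d < fst c \<and> snd d \<le> snd c \<or> fst d \<le> fst c \<and> snd d < snd c"
      using \<open>d < c\<close> by (cases c; cases d) (auto simp: less_prod_def less_eq_prod_def)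
    then have "level d + \<bar>int (diagonal d) - int (diagonal c - 1)\<bar> < level c
       \<or> level d + \<bar>int (diagonal d) - int (diagonal c + 1)\<bar> < level c"
      using int_diagonal c int_diagonal d' s by (auto simp: level_def)
    moreover have "\<bar>h (diagonal d) - h (diagonal c - 1)\<bar> \<le> \<bar>int (diagonal d) - int (diagonal c - 1)\<bar>"
      "\<bar>h (diagonal d) - h (diagonal c + 1)\<bar> \<le> \<bar>int (diagonal d) - int (diagonal c + 1)\<bar>"
      using lattice_path_lipschitz[OF h, of "diagonal c - 1" "diagonal d"]
        lattice_path_lipschitz[OF h, of "diagonal c + 1" "diagonal d"] s s' by simp_all
    ultimately show False using c d' unfolding valley_def by linarith
  qed
  with c show "minimal_in (above h) c" by (simp add: minimal_in_def above_def)
qed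

text \<open>The order is reversed: the larger upset is bounded by the lower path.\<close>

lemma upset_pairs_bij_path_pairs:
  "bij_betw (map_prod above above) (path_pairs (m + n) (int n - r) (int m - r) 0) (upset_pairs P)"
proof -
  have iff: "(above l, above u) \<in> upset_pairs P \<longleftrightarrow> (l, u) \<in> path_pairs (m + n) (int n - r) (int m - r) 0"
    if l: "l \<in> paths" and u: "u \<in> paths" for l u
  proof -
    have "(\<forall>c. minimal_in (above l) c \<longrightarrow> c \<notin> above u) \<longleftrightarrow>
          (\<forall>s. 0 < s \<and> s < m + n \<and> valley l s \<longrightarrow> l s < u s)" (is "?L \<longleftrightarrow> ?R")
    proof
      assume L: ?L
      show ?R
      proof (intro allI impI)
        fix s assume s: "0 < s \<and> s < m + n \<and> valley l s"
        then have le: "s - 1 \<le> m + n" "s - Suc 0 \<le> m + n" by auto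
        have "l s + 2 \<le> int n - r + int s" "l s + 2 \<le> 2 * int m + int n - r - int s"
          using path_bounds(4)[OF l, of "s + 1"]
            path_bounds(2)[OF l, of "s - 1"] s le by (auto simp: valley_def of_nat_diff)
        then obtain c where "c \<in> {1..m} \<times> {1..n}" "diagonal c = s" "level c = l s"
          using cell_at[OF l, of s] s by auto
        with s have "minimal_in (above l) c" "c \<in> above u \<longleftrightarrow> u s \<le> l s"
          unfolding minimal_above_iff[OF l] by (auto simp: above_def)
        then show "l s < u s" using L by auto
      qed
    next
      assume R: ?R
      show ?L
      proof (intro allI impI)
        fix c assume "minimal_in (above l) c"
        then have c: "c \<in> {1..m} \<times> {1..n}" "level c = l (diagonal c)" "valley l (diagonal c)"
          unfolding minimal_above_iff[OF l] by blast+
        then have "level c < u (diagonal c)" using R diagonal_bounds by simp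
        then show "c \<notin> above u" by (simp add: above_def)
      qed
    qed
    then show ?thesis
      using l u by (simp add: upset_pairs_def path_pairs_def above_upset above_subset_iff)
  qed
  have sub: "path_pairs (m + n) (int n - r) (int m - r) 0 \<subseteq> paths \<times> paths"
    by (auto simp: path_pairs_def)
  show ?thesis
    unfolding bij_betw_def
  proof
    show "inj_on (map_prod above above) (path_pairs (m + n) (int n - r) (int m - r) 0)"
      using map_prod_inj_on[OF inj_on_above inj_on_above] sub inj_on_subset by blast
    show "map_prod above above ` path_pairs (m + n) (int n - r) (int m - r) 0 = upset_pairs P" (is "?X = _")
    proof
      show "?X \<subseteq> upset_pairs P" using iff sub by auto
      show "upset_pairs P \<subseteq> ?X"
      proof clarify
        fix A B assume AB: "(A, B) \<in> upset_pairs P"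
        then have "A \<in> above ` paths" "B \<in> above ` paths"
          by (auto simp: upset_pairs_def intro: ex_path_of_upset)
        then obtain l u where "l \<in> paths" "A = above l" "u \<in> paths" "B = above u" by blast
        with iff AB show "(A, B) \<in> ?X" by (auto intro!: image_eqI[of _ _ "(l, u)"])
      qed
    qed
  qed
qed

lemma card_interval_closed_sets:
  "card (interval_closed_sets P) = card (path_pairs (m + n) (int n - r) (int m - r) 0)"
  using bij_betw_same_card[OF upset_pairs_bij_path_pairs]
    bij_betw_same_card[OF upset_pairs_bij[OF finite_P]] by simp

end

section \<open>Counting pairs of paths by their last step\<close>

lemma path_pairs_subset:
  "path_pairs k i a b \<subseteq> lattice_paths k i a \<times> lattice_paths k i (a + 2 * b)"
  by (auto simp: path_pairs_def)

lemma path_pairs_empty: "a < 0 \<or> b < 0 \<Longrightarrow> path_pairs k i a b = {}"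
proof -
  assume ab: "a < 0 \<or> b < 0"
  have False if "(l, u) \<in> path_pairs k i a b" for l u
  proof -
    have "0 \<le> l k" "l k = a" "u k = a + 2 * b" "l k \<le> u k"
      using that unfolding path_pairs_def lattice_paths_def le_fun_def by blast+
    then show False using ab by linarith
  qed
  then show ?thesis by auto
qed

lemma lattice_path_0_eq:
  assumes "h \<in> lattice_paths 0 i c" shows "h = (\<lambda>s. if s = 0 then i else 0)"
proof
  fix s show "h s = (if s = 0 then i else 0)" using assms by (simp add: lattice_paths_def)
qed

lemma path_pairs_0:
  assumes "0 \<le> i"
  shows "path_pairs 0 i a b = (if a = i \<and> b = 0
    then {(\<lambda>s. if s = 0 then i else 0, \<lambda>s. if s = 0 then i else 0)} else {})" (is "_ = (if _ then {(?c, ?c)} else {})")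
proof (cases "a = i \<and> b = 0")
  case True
  have "?c \<in> lattice_paths 0 i i" using assms by (simp add: lattice_paths_def)
  then have "(?c, ?c) \<in> path_pairs 0 i a b" using True by (simp add: path_pairs_def)
  moreover have "p = (?c, ?c)" if "p \<in> path_pairs 0 i a b" for p
  proof -
    have "p \<in> lattice_paths 0 i a \<times> lattice_paths 0 i (a + 2 * b)"
      using path_pairs_subset that by (rule subsetD)
    then have mem: "fst p \<in> lattice_paths 0 i a" "snd p \<in> lattice_paths 0 i (a + 2 * b)"
      by (simp_all add: mem_Times_iff)
    note lattice_path_0_eq[OF mem(1)] lattice_path_0_eq[OF mem(2)]
    then show ?thesis by (metis prod.collapse)
  qed
  ultimately have "path_pairs 0 i a b = {(?c, ?c)}" by blast
  then show ?thesis using True by simp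
next
  case False
  have "path_pairs 0 i a b = {}"
  proof (rule equals0I)
    fix p assume p: "p \<in> path_pairs 0 i a b"
    have "fst p \<in> lattice_paths 0 i a" "snd p \<in> lattice_paths 0 i (a + 2 * b)"
      using subsetD[OF path_pairs_subset p] by (simp_all add: mem_Times_iff)
    then show False using False by (simp add: lattice_paths_def)
  qed
  then show ?thesis unfolding if_not_P[OF False] .
qed

definition extend :: "nat \<Rightarrow> int \<Rightarrow> (nat \<Rightarrow> int) \<Rightarrow> nat \<Rightarrow> int" where
  "extend k a h = h(Suc k := a)"

lemma extend_path_iff:
  assumes "0 \<le> a"
  shows "h \<in> lattice_paths (Suc k) i a \<longleftrightarrow>
    (\<exists>h' a'. h' \<in> lattice_paths k i a' \<and> \<bar>a - a'\<bar> = 1 \<and> h = extend k a h')"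
proof
  assume h: "h \<in> lattice_paths (Suc k) i a"
  then have "h(Suc k := 0) \<in> lattice_paths k i (h k)"
    by (auto simp: lattice_paths_def)
  moreover have "\<bar>a - h k\<bar> = 1" using h by (auto simp: lattice_paths_def)
  moreover have "h = extend k a (h(Suc k := 0))" using h by (auto simp: extend_def lattice_paths_def)
  ultimately show "\<exists>h' a'. h' \<in> lattice_paths k i a' \<and> \<bar>a - a'\<bar> = 1 \<and> h = extend k a h'" by blast
next
  assume "\<exists>h' a'. h' \<in> lattice_paths k i a' \<and> \<bar>a - a'\<bar> = 1 \<and> h = extend k a h'"
  then show "h \<in> lattice_paths (Suc k) i a"
    using assms by (auto simp: lattice_paths_def extend_def less_Suc_eq)
qed

lemma finite_lattice_paths: "finite (lattice_paths k i a)"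
proof (induction k arbitrary: a)
  case 0
  have "lattice_paths 0 i a \<subseteq> {\<lambda>s. if s = 0 then i else 0}" using lattice_path_0_eq by blast
  then show ?case using finite_subset by blast
next
  case (Suc k)
  have "lattice_paths (Suc k) i a \<subseteq>
      extend k a ` (lattice_paths k i (a - 1) \<union> lattice_paths k i (a + 1))"
  proof
    fix h assume h: "h \<in> lattice_paths (Suc k) i a"
    then have "0 \<le> a" by (auto simp: lattice_paths_def)
    with h obtain h' a' where "h' \<in> lattice_paths k i a'" "\<bar>a - a'\<bar> = 1" "h = extend k a h'"
      using extend_path_iff by blast
    moreover from this(2) have "a' = a - 1 \<or> a' = a + 1" by linarith
    ultimately show "h \<in> extend k a ` (lattice_paths k i (a - 1) \<union> lattice_paths k i (a + 1))" by auto
  qed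
  then show ?case using Suc finite_subset by blast
qed

lemma finite_path_pairs: "finite (path_pairs k i a b)"
  using path_pairs_subset finite_lattice_paths by (meson finite_SigmaI finite_subset)

definition extend_pair ::
  "nat \<Rightarrow> int \<Rightarrow> int \<Rightarrow> (nat \<Rightarrow> int) \<times> (nat \<Rightarrow> int) \<Rightarrow> (nat \<Rightarrow> int) \<times> (nat \<Rightarrow> int)" where
  "extend_pair k a b = map_prod (extend k a) (extend k (a + 2 * b))"

text \<open>Length \<open>Suc k\<close> with a forbidden valley at \<open>k\<close>: as \<open>l \<le> u\<close>, both paths descend from \<open>a\<close> to
  \<open>a - 1\<close> and return, so deleting the last two steps leaves an arbitrary admissible pair that ends
  at the same point.\<close>

definition last_valley_pairs :: "nat \<Rightarrow> int \<Rightarrow> int \<Rightarrow> int \<Rightarrow> ((nat \<Rightarrow> int) \<times> (nat \<Rightarrow> int)) set" where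
  "last_valley_pairs k i a b = (if b = 0 \<and> 0 < a \<and> 0 < k
     then extend_pair k a 0 ` extend_pair (k - 1) (a - 1) 0 ` path_pairs (k - 1) i a 0 else {})"

text \<open>Pairs of length \<open>Suc k\<close> whose last interior point \<open>k\<close> is exempt from the valley condition.
  These are the extensions of admissible pairs of length \<open>k\<close> by one arbitrary step.\<close>

definition weak_pairs :: "nat \<Rightarrow> int \<Rightarrow> int \<Rightarrow> int \<Rightarrow> ((nat \<Rightarrow> int) \<times> (nat \<Rightarrow> int)) set" where
  "weak_pairs k i a b = {(l, u). l \<in> lattice_paths (Suc k) i a \<and> u \<in> lattice_paths (Suc k) i (a + 2 * b)
     \<and> l \<le> u \<and> (\<forall>s. 0 < s \<and> s < k \<and> valley l s \<longrightarrow> l s < u s)}"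

lemma valley_extend: "s < k \<Longrightarrow> valley (extend k a h) s = valley h s"
  by (auto simp: valley_def extend_def)

text \<open>Each of the two paths arrives from one below or one above; the four combinations are the steps
  of the walk \<open>(l, (u - l) / 2)\<close>.\<close>

lemma weak_pairs_eq:
  assumes ab: "0 \<le> a" "0 \<le> b"
  shows "weak_pairs k i a b = extend_pair k a b `
    (path_pairs k i (a - 1) b \<union> path_pairs k i (a + 1) b \<union>
     path_pairs k i (a - 1) (b + 1) \<union> path_pairs k i (a + 1) (b - 1))" (is "_ = _ ` ?U")
proof (intro set_eqI iffI)
  fix p assume p: "p \<in> weak_pairs k i a b"
  obtain l u where lu: "p = (l, u)" by (cases p)
  have l: "l \<in> lattice_paths (Suc k) i a" and u: "u \<in> lattice_paths (Suc k) i (a + 2 * b)"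
    and le: "l \<le> u" and v: "\<And>s. 0 < s \<Longrightarrow> s < k \<Longrightarrow> valley l s \<Longrightarrow> l s < u s"
    using p lu by (auto simp: weak_pairs_def)
  obtain l' a' where l': "l' \<in> lattice_paths k i a'" "\<bar>a - a'\<bar> = 1" "l = extend k a l'"
    using l extend_path_iff ab by blast
  have "0 \<le> a + 2 * b" using ab by simp
  then obtain u' c where u': "u' \<in> lattice_paths k i c" "\<bar>a + 2 * b - c\<bar> = 1" "u = extend k (a + 2 * b) u'"
    using u extend_path_iff by blast
  have le': "l' \<le> u'"
  proof (rule le_funI)
    fix s show "l' s \<le> u' s"
    proof (cases "s = Suc k")
      case True then show ?thesis using l'(1) u'(1) by (auto simp: lattice_paths_def)
    next
      case False then show ?thesis using le_funD[OF le, of s] l'(3) u'(3) by (simp add: extend_def)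
    qed
  qed
  have "\<forall>s. 0 < s \<and> s < k \<and> valley l' s \<longrightarrow> l' s < u' s"
    using v valley_extend unfolding l'(3) u'(3) by (fastforce simp: extend_def)
  then have mem: "(l', u') \<in> path_pairs k i a' b'" if "c = a' + 2 * b'" for b'
    using l'(1) u'(1) le' that by (simp add: path_pairs_def)
  have "a' = a - 1 \<or> a' = a + 1" "c = a + 2 * b - 1 \<or> c = a + 2 * b + 1"
    using l'(2) u'(2) by linarith+
  then have "(l', u') \<in> ?U"
    using mem[of b] mem[of "b + 1"] mem[of "b - 1"] by auto
  then show "p \<in> extend_pair k a b ` ?U"
    using lu l' u' by (auto simp: extend_pair_def intro!: image_eqI[of _ _ "(l', u')"])
next
  fix p assume "p \<in> extend_pair k a b ` ?U"
  then obtain l' u' a' b' where p: "p = (extend k a l', extend k (a + 2 * b) u')"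
    and mem: "(l', u') \<in> path_pairs k i a' b'"
    and *: "\<bar>a - a'\<bar> = 1" "\<bar>a + 2 * b - (a' + 2 * b')\<bar> = 1"
    by (force simp: extend_pair_def)
  have "extend k a l' \<in> lattice_paths (Suc k) i a"
    using extend_path_iff ab(1) *(1) mem by (auto simp: path_pairs_def)
  moreover have "extend k (a + 2 * b) u' \<in> lattice_paths (Suc k) i (a + 2 * b)"
    using extend_path_iff[of "a + 2 * b"] ab *(2) mem by (auto simp: path_pairs_def)
  moreover have "extend k a l' \<le> extend k (a + 2 * b) u'"
    using mem ab by (auto simp: path_pairs_def le_fun_def extend_def)
  moreover have "\<forall>s. 0 < s \<and> s < k \<and> valley (extend k a l') s \<longrightarrow> extend k a l' s < extend k (a + 2 * b) u' s"
    using mem valley_extend by (auto simp: path_pairs_def extend_def)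
  ultimately show "p \<in> weak_pairs k i a b" by (simp add: p weak_pairs_def)
qed

lemma path_pairs_Suc_subset: "path_pairs (Suc k) i a b \<subseteq> weak_pairs k i a b"
  by (auto simp: weak_pairs_def path_pairs_def)

text \<open>At a violated valley of \<open>l\<close> at time \<open>k\<close> the paths meet, and since \<open>u\<close> moves by unit steps and is
  not below \<open>l\<close> at the neighbouring times, it has the same heights there.  Conversely, the two steps
  appended to a pair do not create any other violation, because \<open>l\<close> descends from time \<open>k - 1\<close> to \<open>k\<close>.\<close>

lemma weak_minus_path_pairs:
  assumes ab: "0 \<le> a" "0 \<le> b"
  shows "weak_pairs k i a b - path_pairs (Suc k) i a b = last_valley_pairs k i a b"
proof (intro set_eqI iffI)
  fix p assume p: "p \<in> weak_pairs k i a b - path_pairs (Suc k) i a b"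
  obtain l u where lu: "p = (l, u)" by (cases p)
  have l: "l \<in> lattice_paths (Suc k) i a" and u: "u \<in> lattice_paths (Suc k) i (a + 2 * b)"
    and le: "l \<le> u" and v: "\<And>s. 0 < s \<Longrightarrow> s < k \<Longrightarrow> valley l s \<Longrightarrow> l s < u s"
    using p lu by (auto simp: weak_pairs_def)
  obtain s where s: "0 < s" "s < Suc k" "valley l s" "\<not> l s < u s"
    using p lu l u le by (auto simp: weak_pairs_def path_pairs_def)
  then have "s = k" using v[of s] by (cases "s < k") auto
  with s have k: "0 < k" "valley l k" and "u k \<le> l k" by auto
  then have eq: "u k = l k" using le_funD[OF le, of k] by simp
  obtain j where j: "k = Suc j" using k by (cases k) auto
  have lv: "l j = l k + 1" "l (Suc k) = l k + 1" using k j by (auto simp: valley_def)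
  have ends: "l (Suc k) = a" "u (Suc k) = a + 2 * b" using l u by (auto simp: lattice_paths_def)
  have "\<bar>u k - u j\<bar> = 1" "\<bar>u (Suc k) - u k\<bar> = 1" using u j by (auto simp: lattice_paths_def)
  then have uj: "u j = a" "b = 0" using eq lv ends ab le_funD[OF le, of j] by auto
  have apos: "0 < a" using lv ends lattice_path_nonneg[OF l, of k] by simp
  define l' where "l' = l(Suc k := 0, k := 0)"
  define u' where "u' = u(Suc k := 0, k := 0)"
  have "l' \<in> lattice_paths j i a" "u' \<in> lattice_paths j i a"
    using l u j lv ends uj by (auto simp: lattice_paths_def l'_def u'_def)
  moreover have "l' \<le> u'" using le by (auto simp: le_fun_def l'_def u'_def)
  moreover have "\<forall>s. 0 < s \<and> s < j \<and> valley l' s \<longrightarrow> l' s < u' s"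
    using v j by (auto simp: l'_def u'_def valley_def)
  ultimately have "(l', u') \<in> path_pairs j i a 0" by (simp add: path_pairs_def)
  moreover have "p = extend_pair k a 0 (extend_pair j (a - 1) 0 (l', u'))"
    using lu eq lv ends uj j by (auto simp: extend_pair_def extend_def l'_def u'_def fun_eq_iff)
  ultimately show "p \<in> last_valley_pairs k i a b"
    using uj apos k j by (auto simp: last_valley_pairs_def)
next
  fix p assume p: "p \<in> last_valley_pairs k i a b"
  then have b: "b = 0" "0 < a" "0 < k" by (auto simp: last_valley_pairs_def split: if_splits)
  obtain j where j: "k = Suc j" using b by (cases k) auto
  obtain l u where lu: "(l, u) \<in> path_pairs j i a 0"
    and pe: "p = (extend k a (extend j (a - 1) l), extend k a (extend j (a - 1) u))"
    using p b j by (auto simp: last_valley_pairs_def extend_pair_def)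
  let ?l = "extend j (a - 1) l" and ?u = "extend j (a - 1) u"
  have l: "l \<in> lattice_paths j i a" and u: "u \<in> lattice_paths j i a" and le: "l \<le> u"
    and v: "\<And>s. 0 < s \<Longrightarrow> s < j \<Longrightarrow> valley l s \<Longrightarrow> l s < u s"
    using lu by (auto simp: path_pairs_def)
  have l1: "?l \<in> lattice_paths k i (a - 1)" and u1: "?u \<in> lattice_paths k i (a - 1)"
    using l u extend_path_iff[of "a - 1"] b unfolding j by force+
  have vj: "\<not> valley ?l j" if "0 < j"
    using l that by (auto simp: valley_def extend_def lattice_paths_def)
  have "?l s < ?u s" if "0 < s" "s < k" "valley ?l s" for s
  proof -
    have "s \<noteq> j" using vj that by auto
    then have "s < j" using that j by simp
    then show ?thesis using v[of s] that valley_extend[of s j] by (auto simp: extend_def)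
  qed
  moreover have "?l \<le> ?u" using le by (auto simp: le_fun_def extend_def)
  ultimately have "(?l, ?u) \<in> path_pairs k i (a - 1) 0"
    using l1 u1 by (simp add: path_pairs_def)
  then have "extend_pair k a 0 (?l, ?u) \<in> weak_pairs k i a 0"
    using b by (simp add: weak_pairs_eq)
  moreover have "p = extend_pair k a 0 (?l, ?u)" by (simp add: pe extend_pair_def)
  moreover have "p \<notin> path_pairs (Suc k) i a b"
  proof
    assume "p \<in> path_pairs (Suc k) i a b"
    then have *: "valley (extend k a ?l) k \<longrightarrow> extend k a ?l k < extend k a ?u k"
      using b by (auto simp: pe path_pairs_def)
    have "l j = a" using l by (auto simp: lattice_paths_def)
    then show False using * j by (simp add: extend_def valley_def)
  qed
  ultimately show "p \<in> weak_pairs k i a b - path_pairs (Suc k) i a b" using b by simp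
qed

definition path_pair_count :: "nat \<Rightarrow> int \<Rightarrow> int \<Rightarrow> int \<Rightarrow> int" where
  "path_pair_count k i a b = int (card (path_pairs k i a b))"

lemma path_pairs_disjoint:
  assumes "(a, b) \<noteq> (a', b')" shows "path_pairs k i a b \<inter> path_pairs k i a' b' = {}"
  using assms by (auto simp: path_pairs_def lattice_paths_def)

text \<open>Extension overwrites the height at \<open>Suc k\<close>, so nothing is lost on functions vanishing there.\<close>

lemma extend_pair_inj: "inj_on (extend_pair k a b) {(l, u). l (Suc k) = 0 \<and> u (Suc k) = 0}"
proof (rule inj_onI, clarify)
  fix l u l' u' :: "nat \<Rightarrow> int"
  assume z: "l (Suc k) = 0" "u (Suc k) = 0" "l' (Suc k) = 0" "u' (Suc k) = 0"
    and eq: "extend_pair k a b (l, u) = extend_pair k a b (l', u')"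
  have "g = h" if "g (Suc k) = 0" "h (Suc k) = 0" "extend k c g = extend k c h" for g h c
    using that by (metis extend_def fun_upd_triv fun_upd_upd)
  then show "l = l' \<and> u = u'" using z eq unfolding extend_pair_def by (metis map_prod_simp prod.inject)
qed

lemma path_pairs_vanish: "k < s \<Longrightarrow> path_pairs k i a b \<subseteq> {(l, u). l s = 0 \<and> u s = 0}"
  by (auto simp: path_pairs_def lattice_paths_def)

text \<open>Counts for negative coordinates vanish, so that steps from outside the quarter plane need no
  separate treatment.\<close>

lemma path_pair_count_Suc:
  assumes ab: "0 \<le> a" "0 \<le> b"
  shows "path_pair_count (Suc k) i a b = path_pair_count k i (a - 1) b + path_pair_count k i (a + 1) b + path_pair_count k i (a - 1) (b + 1) + path_pair_count k i (a + 1) (b - 1)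
    - (if b = 0 \<and> 0 < a \<and> 0 < k then path_pair_count (k - 1) i a 0 else 0)"
proof -
  let ?U = "path_pairs k i (a - 1) b \<union> path_pairs k i (a + 1) b \<union>
     path_pairs k i (a - 1) (b + 1) \<union> path_pairs k i (a + 1) (b - 1)"
  have inj: "inj_on (extend_pair k a b) ?U"
    by (rule inj_on_subset[OF extend_pair_inj]) (intro Un_least path_pairs_vanish lessI)
  have "card (weak_pairs k i a b) = card ?U"
    unfolding weak_pairs_eq[OF ab] by (rule card_image[OF inj])
  also have "\<dots> = card (path_pairs k i (a - 1) b) + card (path_pairs k i (a + 1) b) +
     card (path_pairs k i (a - 1) (b + 1)) + card (path_pairs k i (a + 1) (b - 1))"
    by (simp add: card_Un_disjoint finite_path_pairs path_pairs_disjoint Int_Un_distrib2)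
  finally have 1: "int (card (weak_pairs k i a b)) =
      path_pair_count k i (a - 1) b + path_pair_count k i (a + 1) b + path_pair_count k i (a - 1) (b + 1) + path_pair_count k i (a + 1) (b - 1)"
    by (simp add: path_pair_count_def)
  have fin: "finite (weak_pairs k i a b)" unfolding weak_pairs_eq[OF ab] by (simp add: finite_path_pairs)
  have "card (weak_pairs k i a b) = card (path_pairs (Suc k) i a b) + card (last_valley_pairs k i a b)"
    using card_Diff_subset[OF finite_path_pairs path_pairs_Suc_subset, of k i a b]
      card_mono[OF fin path_pairs_Suc_subset]
    unfolding weak_minus_path_pairs[OF ab] by simp
  moreover have "int (card (last_valley_pairs k i a b)) = (if b = 0 \<and> 0 < a \<and> 0 < k then path_pair_count (k - 1) i a 0 else 0)"
  proof (cases "b = 0 \<and> 0 < a \<and> 0 < k")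
    case True
    then obtain j where j: "k = Suc j" by (cases k) auto
    have van: "path_pairs j i a 0 \<subseteq> {(l, u). l s = 0 \<and> u s = 0}" if "j < s" for s
      using path_pairs_vanish[OF that] .
    have "inj_on (extend_pair j (a - 1) 0) (path_pairs j i a 0)"
      by (rule inj_on_subset[OF extend_pair_inj van]) simp
    moreover have "inj_on (extend_pair k a 0) (extend_pair j (a - 1) 0 ` path_pairs j i a 0)"
    proof (rule inj_on_subset[OF extend_pair_inj])
      show "extend_pair j (a - 1) 0 ` path_pairs j i a 0 \<subseteq> {(l, u). l (Suc k) = 0 \<and> u (Suc k) = 0}"
        using van[of "Suc k"] j by (auto simp: extend_pair_def extend_def)
    qed
    ultimately show ?thesis
      using True j by (simp add: last_valley_pairs_def card_image path_pair_count_def)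
  next
    case False
    then have "last_valley_pairs k i a b = {}" by (auto simp: last_valley_pairs_def)
    then show ?thesis using False by auto
  qed
  ultimately show ?thesis using 1 by (simp add: path_pair_count_def)
qed

section \<open>The functional equation as a recursion for polynomials\<close>

definition var_x :: "int poly poly" where "var_x = [:[:0, 1:]:]"
definition var_y :: "int poly poly" where "var_y = [:0, 1:]"

definition set_x0 :: "int poly poly \<Rightarrow> int poly poly" where "set_x0 = map_poly (\<lambda>q. [:poly q 0:])"
definition set_y0 :: "int poly poly \<Rightarrow> int poly poly" where "set_y0 p = [:poly p 0:]"

definition div_x :: "int poly poly \<Rightarrow> int poly poly" where "div_x = map_poly (poly_shift 1)"
definition div_y :: "int poly poly \<Rightarrow> int poly poly" where "div_y = poly_shift 1"

text \<open>One step of a quarter-plane walk, on generating polynomials.  The divisions \<open>div_x\<close>, \<open>div_y\<close>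
  drop the terms not divisible by the variable, which belong to steps leaving the quarter plane.\<close>

definition quadrant_step :: "int poly poly \<Rightarrow> int poly poly" where
  "quadrant_step p = var_x * p + div_x p + var_y * div_x p + var_x * div_y p"

lemma coeff_var_x_mult: "coeff (coeff (var_x * p) b) a = (if a = 0 then 0 else coeff (coeff p b) (a - 1))"
  by (cases a) (simp_all add: var_x_def coeff_pCons)

lemma coeff_var_y_mult: "coeff (var_y * p) b = (if b = 0 then 0 else coeff p (b - 1))"
  by (cases b) (simp_all add: var_y_def coeff_pCons)

lemma coeff_div_x: "coeff (coeff (div_x p) b) a = coeff (coeff p b) (Suc a)"
  by (simp add: div_x_def coeff_map_poly coeff_poly_shift)

lemma coeff_div_y: "coeff (div_y p) b = coeff p (Suc b)"
  by (simp add: div_y_def coeff_poly_shift)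

lemma coeff_set_x0: "coeff (coeff (set_x0 p) b) a = (if a = 0 then coeff (coeff p b) 0 else 0)"
  by (cases a) (simp_all add: set_x0_def coeff_map_poly poly_0_coeff_0)

lemma coeff_set_y0: "coeff (set_y0 p) b = (if b = 0 then coeff p 0 else 0)"
  by (cases b) (simp_all add: set_y0_def poly_0_coeff_0)

lemma poly2_eqI:
  fixes p q :: "int poly poly"
  assumes "\<And>a b. coeff (coeff p b) a = coeff (coeff q b) a" shows "p = q"
  using assms by (intro poly_eqI)

lemma var_x_div_x: "var_x * div_x p = p - set_x0 p"
  by (rule poly2_eqI) (simp add: coeff_var_x_mult coeff_div_x coeff_set_x0)

lemma var_y_div_y: "var_y * div_y p = p - set_y0 p"
  by (rule poly_eqI) (simp add: coeff_var_y_mult coeff_div_y coeff_set_y0)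

lemma var_x_power: "var_x ^ i = [:monom 1 i:]"
  by (simp add: var_x_def poly_const_pow monom_altdef)

lemma map_coeffs_nth: "fps_nth (fps_nth (map_coeffs f G) k) i = f (fps_nth (fps_nth G k) i)"
  by (simp add: map_coeffs_def)

lemma to_fract_power: "to_fract (p ^ i) = to_fract p ^ i"
  by (induction i) simp_all

lemma geometric_nth:
  fixes x :: "'a::field"
  shows "fps_nth (1 / (1 - fps_X * fps_const x)) i = x ^ i"
proof -
  define D where "D = 1 - fps_X * fps_const x"
  have "D * Abs_fps (\<lambda>i. x ^ i) = 1"
  proof (rule fps_ext)
    fix i show "fps_nth (D * Abs_fps (\<lambda>i. x ^ i)) i = fps_nth 1 i"
      by (cases i) (simp_all add: D_def left_diff_distrib mult.assoc)
  qed
  moreover have "fps_nth D 0 \<noteq> 0" by (simp add: D_def)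
  ultimately have "1 / D = Abs_fps (\<lambda>i. x ^ i)"
    by (metis fps_divide_unit fps_inverse_unique mult_1)
  then show ?thesis by (simp add: D_def)
qed

text \<open>Both divisions are exact after subtracting the value at \<open>0\<close>; this accounts for the terms with
  \<open>G(0,y)\<close> and \<open>G(x,0)\<close>.\<close>

lemma quadrant_step_rational:
  fixes x y :: "int poly poly fract"
  defines "x \<equiv> to_fract var_x" and "y \<equiv> to_fract var_y"
  shows "(x + 1 / x + x / y + y / x) * to_fract p - (1 / x + y / x) * to_fract (set_x0 p)
      - (x / y) * to_fract (set_y0 p) = to_fract (quadrant_step p)"
proof -
  have nz: "x \<noteq> 0" "y \<noteq> 0" by (simp_all add: x_def y_def var_x_def var_y_def)
  have "x * to_fract (div_x p) = to_fract p - to_fract (set_x0 p)"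
    unfolding x_def to_fract_mult[symmetric] var_x_div_x by simp
  then have 1: "to_fract (div_x p) = (to_fract p - to_fract (set_x0 p)) / x" using nz by (simp add: field_simps)
  have "y * to_fract (div_y p) = to_fract p - to_fract (set_y0 p)"
    unfolding y_def to_fract_mult[symmetric] var_y_div_y by simp
  then have 2: "to_fract (div_y p) = (to_fract p - to_fract (set_y0 p)) / y" using nz by (simp add: field_simps)
  have "to_fract (quadrant_step p) = x * to_fract p + to_fract (div_x p) + y * to_fract (div_x p) + x * to_fract (div_y p)"
    by (simp add: quadrant_step_def x_def y_def)
  then have "to_fract (quadrant_step p) = x * to_fract p + (to_fract p - to_fract (set_x0 p)) / x
      + y * ((to_fract p - to_fract (set_x0 p)) / x) + x * ((to_fract p - to_fract (set_y0 p)) / y)"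
    unfolding 1 2 .
  then show ?thesis by (simp add: algebra_simps diff_divide_distrib)
qed

lemma nth_z_times_const:
  fixes F :: "'a::comm_ring_1 fps fps"
  shows "fps_nth (fps_nth (fps_X * fps_const (fps_const u) * F) k) i =
     (if k = 0 then 0 else u * fps_nth (fps_nth F (k - 1)) i)"
proof -
  have "fps_X * fps_const (fps_const u) * F = fps_X * (fps_const (fps_const u) * F)"
    by (rule mult.assoc)
  then show ?thesis by (simp only: fps_X_mult_nth) simp
qed

text \<open>Comparison of the coefficients of \<open>t\<^sup>i z\<^sup>k\<close>.  The equation over \<open>\<rat>(x,y)\<close> descends to \<open>\<int>[x,y]\<close>
  because the embedding into the fraction field is injective.\<close>

lemma functional_equation_iff:
  "functional_equation G \<longleftrightarrow>
     (\<forall>i. fps_nth (fps_nth G 0) i = [:monom 1 i:]) \<and>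
     (\<forall>i. fps_nth (fps_nth G 1) i = quadrant_step (fps_nth (fps_nth G 0) i)) \<and>
     (\<forall>k i. fps_nth (fps_nth G (Suc (Suc k))) i = quadrant_step (fps_nth (fps_nth G (Suc k)) i)
         - (set_y0 (fps_nth (fps_nth G k) i) - set_x0 (set_y0 (fps_nth (fps_nth G k) i))))"
  (is "_ \<longleftrightarrow> ?A \<and> ?B \<and> ?C")
proof -
  let ?g = "\<lambda>k i. fps_nth (fps_nth G k) i"
  define rhs where "rhs k i = (if k = 0 then var_x ^ i else quadrant_step (?g (k - 1) i)
      - (if k = 1 then 0 else set_y0 (?g (k - 2) i) - set_x0 (set_y0 (?g (k - 2) i))))" for k i
  have "functional_equation G \<longleftrightarrow> (\<forall>k i. to_fract (?g k i) = to_fract (rhs k i))"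
  proof -
    have "functional_equation G \<longleftrightarrow> (\<forall>k i. to_fract (?g k i) =
       (if k = 0 then to_fract var_x ^ i else 0) +
       (if k = 0 then 0 else (to_fract var_x + 1 / to_fract var_x + to_fract var_x / to_fract var_y + to_fract var_y / to_fract var_x) * to_fract (?g (k - 1) i))
       - (if k = 0 then 0 else (1 / to_fract var_x + to_fract var_y / to_fract var_x) * to_fract (set_x0 (?g (k - 1) i)))
       - (if k = 0 then 0 else (to_fract var_x / to_fract var_y) * to_fract (set_y0 (?g (k - 1) i)))
       - (if k < 2 then 0 else to_fract (set_y0 (?g (k - 2) i)) - to_fract (set_x0 (set_y0 (?g (k - 2) i)))))"
      unfolding functional_equation_def Let_def var_x_def[symmetric] var_y_def[symmetric] fps_eq_iff
      by (simp only: fps_add_nth fps_sub_nth nth_z_times_const fps_X_power_mult_nth embed_def at_x0_def at_y0_def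
          map_coeffs_nth set_x0_def[symmetric] set_y0_def[symmetric] fps_nth_fps_const if_distrib[of "\<lambda>F. fps_nth F _"] geometric_nth fps_zero_nth cong: if_cong)
    also have "\<dots> \<longleftrightarrow> (\<forall>k i. to_fract (?g k i) = to_fract (rhs k i))"
      unfolding rhs_def using quadrant_step_rational
      by (intro iff_allI arg_cong2[of _ _ _ _ "(=)"] refl) (auto simp: to_fract_power)
    finally show ?thesis .
  qed
  also have "\<dots> \<longleftrightarrow> (\<forall>k i. ?g k i = rhs k i)" by simp
  also have "\<dots> \<longleftrightarrow> ?A \<and> ?B \<and> ?C"
  proof
    assume *: "\<forall>k i. ?g k i = rhs k i"
    show "?A \<and> ?B \<and> ?C"
      using *[rule_format, of 0] *[rule_format, of 1] *[rule_format, of "Suc (Suc _)"]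
      by (simp add: rhs_def var_x_power)
  next
    assume *: "?A \<and> ?B \<and> ?C"
    show "\<forall>k i. ?g k i = rhs k i"
    proof (intro allI)
      fix k i show "?g k i = rhs k i"
      proof (cases k)
        case (Suc j)
        then show ?thesis using * by (cases j) (auto simp: rhs_def)
      qed (use * in \<open>simp add: rhs_def var_x_power\<close>)
    qed
  qed
  finally show ?thesis .
qed

fun solution_coeff :: "nat \<Rightarrow> nat \<Rightarrow> int poly poly" where
  "solution_coeff 0 i = [:monom 1 i:]"
| "solution_coeff (Suc 0) i = quadrant_step (solution_coeff 0 i)"
| "solution_coeff (Suc (Suc k)) i = quadrant_step (solution_coeff (Suc k) i) - (set_y0 (solution_coeff k i) - set_x0 (set_y0 (solution_coeff k i)))"

lemma functional_equation_iff_solution: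
  "functional_equation G \<longleftrightarrow> G = Abs_fps (\<lambda>k. Abs_fps (solution_coeff k))"
proof
  assume *: "functional_equation G"
  have "fps_nth (fps_nth G k) i = solution_coeff k i" for k i
    by (induction k i rule: solution_coeff.induct) (use * in \<open>simp_all add: functional_equation_iff\<close>)
  then show "G = Abs_fps (\<lambda>k. Abs_fps (solution_coeff k))" by (simp add: fps_eq_iff)
qed (simp add: functional_equation_iff)

section \<open>Comparison of the two generating functions\<close>

lemma path_pair_count_negative: "a < 0 \<or> b < 0 \<Longrightarrow> path_pair_count k i a b = 0"
  by (simp add: path_pair_count_def path_pairs_empty)

lemma coeff_quadrant_step: "coeff (coeff (quadrant_step p) b) a =
    (if a = 0 then 0 else coeff (coeff p b) (a - 1)) + coeff (coeff p b) (Suc a)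
    + (if b = 0 then 0 else coeff (coeff p (b - 1)) (Suc a))
    + (if a = 0 then 0 else coeff (coeff p (Suc b)) (a - 1))"
  by (simp add: quadrant_step_def coeff_var_x_mult coeff_var_y_mult coeff_div_x coeff_div_y)

lemma path_pair_count_0: "path_pair_count 0 (int i) (int a) (int b) = (if a = i \<and> b = 0 then 1 else 0)"
  by (simp add: path_pair_count_def path_pairs_0)

lemma coeff_quadrant_step_count:
  assumes "\<And>a b. coeff (coeff p b) a = path_pair_count k i (int a) (int b)"
  shows "coeff (coeff (quadrant_step p) b) a = path_pair_count k i (int a - 1) (int b) + path_pair_count k i (int a + 1) (int b)
    + path_pair_count k i (int a - 1) (int b + 1) + path_pair_count k i (int a + 1) (int b - 1)"
  by (cases a; cases b) (simp_all add: coeff_quadrant_step assms path_pair_count_negative algebra_simps)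

text \<open>The polynomial recursion is \<open>path_pair_count_Suc\<close>, read coefficientwise.\<close>

lemma coeff_solution_coeff: "coeff (coeff (solution_coeff k i) b) a = path_pair_count k (int i) (int a) (int b)"
proof (induction k i arbitrary: a b rule: solution_coeff.induct)
  case (1 i)
  show ?case unfolding path_pair_count_0 by (cases b) simp_all
next
  case (2 i)
  show ?case using coeff_quadrant_step_count[OF 2] path_pair_count_Suc[of "int a" "int b" 0 "int i"] by simp
next
  case (3 k i)
  have "coeff (coeff (set_y0 (solution_coeff k i) - set_x0 (set_y0 (solution_coeff k i))) b) a =
    (if b = 0 \<and> 0 < a then path_pair_count k (int i) (int a) 0 else 0)"
    using "3.IH"(2)[of 0] by (simp add: coeff_set_y0 coeff_set_x0)
  then show ?case
    using coeff_quadrant_step_count[OF "3.IH"(1)] path_pair_count_Suc[of "int a" "int b" "Suc k" "int i"] by simp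
qed

lemma path_pairs_empty_unless:
  assumes "path_pairs k i a b \<noteq> {}"
  shows "\<bar>a - i\<bar> \<le> int k" "even (a + i + int k)"
proof -
  obtain l u where "(l, u) \<in> path_pairs k i a b" using assms by auto
  then have l: "l \<in> lattice_paths k i a" by (simp add: path_pairs_def)
  then have "l 0 = i" "l k = a" by (simp_all add: lattice_paths_def)
  then show "\<bar>a - i\<bar> \<le> int k" "even (a + i + int k)"
    using lattice_path_lipschitz[OF l, of 0 k] lattice_path_parity[OF l, of k] by simp_all
qed

text \<open>At most one triple \<open>(r, m, n)\<close> contributes to \<open>x\<^sup>a t\<^sup>i z\<^sup>k\<close>: it satisfies \<open>m = a + r\<close>, \<open>n = i + r\<close> and
  \<open>2 r = k - i - a\<close>.  If no such triple exists, then by parity or by distance no path of length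
  \<open>k\<close> leads from \<open>i\<close> to \<open>a\<close>, and both sides are \<open>0\<close>.\<close>

lemma coeff_ics_sum:
  "coeff (\<Sum>(r, m, n)\<in>contributing i k.
      monom (int (card (interval_closed_sets (truncated_rectangle m n r)))) (nat (int m - r))) a
   = path_pair_count k (int i) (int a) 0"
proof -
  let ?c = "\<lambda>(r, m, n). int (card (interval_closed_sets (truncated_rectangle m n r)))"
  define D where "D = {t \<in> contributing i k. int (fst (snd t)) - fst t = int a}"
  have "coeff (\<Sum>(r, m, n)\<in>contributing i k.
      monom (int (card (interval_closed_sets (truncated_rectangle m n r)))) (nat (int m - r))) a
    = (\<Sum>t\<in>contributing i k. if int (fst (snd t)) - fst t = int a then ?c t else 0)"
    unfolding coeff_sum
  proof (rule sum.cong[OF refl])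
    fix t assume t: "t \<in> contributing i k"
    obtain r m n where rmn: "t = (r, m, n)" by (cases t)
    then have "nat (int m - r) = a \<longleftrightarrow> int m - r = int a"
      using t by (auto simp: contributing_def)
    then show "coeff (case t of (r, m, n) \<Rightarrow> monom (int (card (interval_closed_sets (truncated_rectangle m n r)))) (nat (int m - r))) a
       = (if int (fst (snd t)) - fst t = int a then ?c t else 0)"
      unfolding rmn by simp
  qed
  also have "\<dots> = sum ?c D"
    unfolding D_def by (rule sum.inter_filter[symmetric, OF finite_contributing])
  also have "\<dots> = (\<Sum>t\<in>D. path_pair_count k (int i) (int a) 0)"
  proof (rule sum.cong[OF refl])
    fix t assume "t \<in> D"
    then obtain r m n where t: "t = (r, m, n)" "r \<le> int m" "r \<le> int n" "int n - r = int i"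
      "int m - r = int a" "m + n = k" by (auto simp: D_def contributing_def)
    interpret truncated_rect m n r using t by unfold_locales
    show "?c t = path_pair_count k (int i) (int a) 0"
      using t card_interval_closed_sets by (simp add: path_pair_count_def)
  qed
  also have "\<dots> = path_pair_count k (int i) (int a) 0"
  proof (cases "path_pairs k (int i) (int a) 0 = {}")
    case True
    then show ?thesis by (simp add: path_pair_count_def)
  next
    case False
    note ne = path_pairs_empty_unless[OF False]
    have "int k - int i - int a = (int a + int i + int k) - 2 * (int i + int a)" by simp
    then have "even (int k - int i - int a)" using ne(2) by (metis dvd_diff dvd_triv_left)
    then obtain r where r: "int k - int i - int a = 2 * r" by blast
    have nn: "0 \<le> int a + r" "0 \<le> int i + r" using ne(1) r by linarith+
    have "D = {(r, nat (int a + r), nat (int i + r))}"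
    proof (intro set_eqI iffI)
      fix t assume "t \<in> D"
      then obtain r' m n where t: "t = (r', m, n)" "int n - r' = int i"
        "int m - r' = int a" "m + n = k" by (auto simp: D_def contributing_def)
      then have "r' = r" using r by linarith
      then show "t \<in> {(r, nat (int a + r), nat (int i + r))}" using t by auto
    next
      fix t assume "t \<in> {(r, nat (int a + r), nat (int i + r))}"
      moreover have "nat (int a + r) + nat (int i + r) = k" using nn r by linarith
      ultimately show "t \<in> D" using nn r by (simp add: D_def contributing_def)
    qed
    then show ?thesis by simp
  qed
  finally show ?thesis .
qed

lemma ics_gf_eq: "ics_gf = at_y0 (Abs_fps (\<lambda>k. Abs_fps (solution_coeff k)))"
proof (intro fps_ext)
  fix k i
  have eq: "poly (solution_coeff k i) 0 = (\<Sum>(r, m, n)\<in>contributing i k.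
      monom (int (card (interval_closed_sets (truncated_rectangle m n r)))) (nat (int m - r)))"
    unfolding poly_0_coeff_0
    using coeff_solution_coeff[of k i 0] coeff_ics_sum[of i k] by (intro poly_eqI) (simp only: of_nat_0)
  then show "fps_nth (fps_nth ics_gf k) i = fps_nth (fps_nth (at_y0 (Abs_fps (\<lambda>k. Abs_fps (solution_coeff k)))) k) i"
    by (simp only: ics_gf_def at_y0_def map_coeffs_nth fps_nth_Abs_fps eq)
qed

theorem theorem4p7:
  shows "(\<exists>!G. functional_equation G) \<and> (\<forall>G. functional_equation G \<longrightarrow> ics_gf = at_y0 G)"
proof -
  have iff: "functional_equation G \<longleftrightarrow> G = Abs_fps (\<lambda>k. Abs_fps (solution_coeff k))" for G
    by (rule functional_equation_iff_solution)
  have "\<exists>!G. functional_equation G"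
  proof (rule ex1I)
    show "functional_equation (Abs_fps (\<lambda>k. Abs_fps (solution_coeff k)))" by (rule iff[THEN iffD2, OF refl])
  qed (rule iff[THEN iffD1])
  moreover have "ics_gf = at_y0 G" if "functional_equation G" for G
    unfolding iff[THEN iffD1, OF that] by (rule ics_gf_eq)
  ultimately show ?thesis by (intro conjI allI impI)
qed

end
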